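(* Let $P_m$ be a path on $m$ vertices and $K_n$ a complete graph on $n$ vertices. Then the sparing number of the edge corona $P_m\diamond K_n$ is $\frac{1}{2}n(n+1)(m-1)$.
   Context: All graphs are simple, finite and have no isolated vertices. $\mathbb{N}_0$ is the set of non-negative integers, $\mathcal{P}(\mathbb{N}_0)$ is its power set, and the sum set of $A,B\subseteq\mathbb{N}_0$ is $A+B=\{a+b: a\in A,\ b\in B\}$. All sets used as labels are finite. An integer additive set-indexer (IASI) of a graph $G$ is an injective function $f:V(G)\to\mathcal{P}(\mathbb{N}_0)$ such that the induced function $f^+:E(G)\to\mathcal{P}(\mathbb{N}_0)$, $f^+(uv)=f(u)+f(v)$, is also injective. It is a weak IASI if $|f^+(uv)|=\max(|f(u)|,|f(v)|)$ for every edge $uv\in E(G)$. An edge $e$ is mono-indexed if $|f^+(e)|=1$. The sparing number $\varphi(G)$ is the minimum number of mono-indexed edges required for $G$ to admit a weak IASI, i.e. the minimum of the number of mono-indexed edges over all weak IASIs of $G$. Edge corona: if $G_1$ has $m_1$ edges, $G_1\diamond G_2$ is the graph obtained from $G_1$ by taking $m_1$ disjoint copies of $G_2$ (one for each edge of $G_1$) and joining both end vertices of the $i$-th edge of $G_1$ to every vertex of the $i$-th copy of $G_2$. *)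

theory Defs
  imports Complex_Main "HOL-Library.Set_Algebras"
begin

record 'a ugraph =
  verts :: "'a set"
  edges :: "'a set set"

definition simple_graph :: "'a ugraph \<Rightarrow> bool" where
  "simple_graph G \<longleftrightarrow> finite (verts G) \<and> (\<forall>e\<in>edges G. e \<subseteq> verts G \<and> card e = 2)"

definition path_graph :: "nat \<Rightarrow> 'a ugraph \<Rightarrow> bool" where
  "path_graph m G \<longleftrightarrow>
     (\<exists>p. bij_betw p {..<m} (verts G) \<and> edges G = {{p i, p (Suc i)} | i. Suc i < m})"

definition complete_graph :: "nat \<Rightarrow> 'a ugraph \<Rightarrow> bool" where
  "complete_graph n G \<longleftrightarrow>
     finite (verts G) \<and> card (verts G) = n \<and>
     edges G = {{u, v} | u v. u \<in> verts G \<and> v \<in> verts G \<and> u \<noteq> v}"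

text \<open>The vertex \<open>Inr (e, w)\<close> is the vertex \<open>w\<close> in the copy of the second graph
  that belongs to the edge \<open>e\<close> of the first.\<close>

definition edge_corona :: "'a ugraph \<Rightarrow> 'b ugraph \<Rightarrow> ('a + 'a set \<times> 'b) ugraph" where
  "edge_corona G H =
     \<lparr>verts = Inl ` verts G \<union> Inr ` (edges G \<times> verts H),
      edges = {Inl ` e | e. e \<in> edges G}
            \<union> {(\<lambda>w. Inr (e, w)) ` d | e d. e \<in> edges G \<and> d \<in> edges H}
            \<union> {{Inl v, Inr (e, w)} | v e w. e \<in> edges G \<and> v \<in> e \<and> w \<in> verts H}\<rparr>"

text \<open>Addition on \<open>nat set\<close> is the sum set of \<^theory>\<open>HOL-Library.Set_Algebras\<close>. Summing the
  labels of the two elements of an edge avoids choosing an order of its ends.\<close>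

definition edge_label :: "('a \<Rightarrow> nat set) \<Rightarrow> 'a set \<Rightarrow> nat set" where
  "edge_label f e = (\<Sum>v\<in>e. f v)"

lemma edge_label_doubleton: "u \<noteq> v \<Longrightarrow> edge_label f {u, v} = f u + f v"
  by (simp add: edge_label_def)

definition IASI :: "'a ugraph \<Rightarrow> ('a \<Rightarrow> nat set) \<Rightarrow> bool" where
  "IASI G f \<longleftrightarrow>
     (\<forall>v\<in>verts G. finite (f v)) \<and> inj_on f (verts G) \<and> inj_on (edge_label f) (edges G)"

definition weak_IASI :: "'a ugraph \<Rightarrow> ('a \<Rightarrow> nat set) \<Rightarrow> bool" where
  "weak_IASI G f \<longleftrightarrow>
     IASI G f \<and>
     (\<forall>u v. {u, v} \<in> edges G \<longrightarrow> card (edge_label f {u, v}) = max (card (f u)) (card (f v)))"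

definition mono_indexed_edges :: "'a ugraph \<Rightarrow> ('a \<Rightarrow> nat set) \<Rightarrow> 'a set set" where
  "mono_indexed_edges G f = {e \<in> edges G. card (edge_label f e) = 1}"

definition sparing_number :: "'a ugraph \<Rightarrow> nat" where
  "sparing_number G = (LEAST k. \<exists>f. weak_IASI G f \<and> card (mono_indexed_edges G f) = k)"

lemma simple_graph_path: "path_graph m G \<Longrightarrow> simple_graph G"
proof -
  assume "path_graph m G"
  then obtain p where p: "bij_betw p {..<m} (verts G)"
    and E: "edges G = {{p i, p (Suc i)} | i. Suc i < m}"
    by (auto simp: path_graph_def)
  have "finite (verts G)"
    using p bij_betw_finite by blast
  moreover have "{p i, p (Suc i)} \<subseteq> verts G \<and> card {p i, p (Suc i)} = 2" if "Suc i < m" for i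
  proof -
    have "p i \<noteq> p (Suc i)"
      using that inj_onD[OF bij_betw_imp_inj_on[OF p], of i "Suc i"] by auto
    then show ?thesis
      using that bij_betwE[OF p] by auto
  qed
  ultimately show ?thesis
    by (auto simp: simple_graph_def E)
qed

lemma simple_graph_complete: "complete_graph n G \<Longrightarrow> simple_graph G"
  by (auto simp: complete_graph_def simple_graph_def)

lemma simple_graph_edge_corona:
  assumes "simple_graph G" "simple_graph H"
  shows "simple_graph (edge_corona G H)"
proof -
  have fin: "finite (edges G)"
    using assms(1) by (auto simp: simple_graph_def intro: finite_subset[of _ "Pow (verts G)"])
  have Inl: "card (Inl ` e :: ('a + 'a set \<times> 'b) set) = card e" for e :: "'a set"
    by (simp add: card_image)
  have Inr: "card ((\<lambda>w. Inr (e, w)) ` d :: ('a + 'a set \<times> 'b) set) = card d" for e d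
    by (simp add: card_image inj_on_def)
  have "finite (verts (edge_corona G H))"
    using assms fin by (auto simp: simple_graph_def edge_corona_def)
  moreover have "e \<subseteq> verts (edge_corona G H)" if "e \<in> edges (edge_corona G H)" for e
    using that assms unfolding simple_graph_def edge_corona_def by simp blast
  moreover have "card e = 2" if "e \<in> edges (edge_corona G H)" for e
    using that assms Inl Inr unfolding simple_graph_def edge_corona_def by auto
  ultimately show ?thesis
    by (simp add: simple_graph_def)
qed

end

theory Submission
  imports Defs "HOL-Library.Nat_Bijection"
begin

text \<open>Two finite sets of naturals with at least two elements each have a sum set larger than both
  of them, and the labels at the ends of an edge are never empty, so in a weak IASI every edge has
  an end with a singleton label. Hence the vertices with a label of another size form an
  independent set, and the mono-indexed edges are exactly the edges that avoid it
  (\<open>weak_IASI_independent\<close>). Conversely, every independent set yields a weak IASI whose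
  mono-indexed edges are those that avoid it (\<open>independent_weak_IASI\<close>): labels whose minima are
  distinct powers of two make all injectivity conditions automatic. The sparing number is therefore
  the least number of edges that avoid an independent set.

  In the edge corona of \<open>G\<close> with \<open>K\<^sub>n\<close>, each edge of \<open>G\<close> together with its copy of \<open>K\<^sub>n\<close>
  spans a clique on \<open>n + 2\<close> vertices. Every edge of the corona lies in exactly one of
  these cliques, since two of them have at most one vertex in common. An independent set meets a
  clique at most once, so it leaves at least \<open>(n + 1) choose 2\<close> edges of each clique untouched;
  equality holds for all cliques at once if the set consists of one vertex from each copy of
  \<open>K\<^sub>n\<close>. This works for every simple graph \<open>G\<close> and \<open>n \<ge> 1\<close>, and a path on \<open>m\<close> vertices has \<open>m - 1\<close>
  edges.\<close>

section \<open>Weak set-indexers and independent sets\<close>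

definition independent :: "'a ugraph \<Rightarrow> 'a set \<Rightarrow> bool" where
  "independent G I \<longleftrightarrow> (\<forall>u v. {u, v} \<in> edges G \<longrightarrow> u \<notin> I \<or> v \<notin> I)"

lemma simple_graph_edgeE:
  assumes "simple_graph G" "e \<in> edges G"
  obtains u v where "e = {u, v}" "u \<noteq> v" "u \<in> verts G" "v \<in> verts G"
  using assms unfolding simple_graph_def by (metis card_2_iff insert_subset)

lemma finite_edges: "simple_graph G \<Longrightarrow> finite (edges G)"
  by (auto simp: simple_graph_def intro: finite_subset[of _ "Pow (verts G)"])

text \<open>The translate of \<open>A\<close> by \<open>Min B\<close> lies in \<open>A + B\<close> and misses the largest
  sum \<open>Max A + Max B\<close>.\<close>

lemma card_less_card_sumset:
  fixes A B :: "nat set"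
  assumes "finite A" "finite B" "A \<noteq> {}" "card B \<ge> 2"
  shows "card A < card (A + B)"
proof -
  have "B \<noteq> {}" using assms by auto
  have "Min B < Max B"
  proof (rule ccontr)
    assume "\<not> Min B < Max B"
    then have "B \<subseteq> {Min B}"
      using Min_le[OF assms(2)] Max_ge[OF assms(2)] by (force intro: antisym)
    then have "card B \<le> 1"
      using card_mono[of "{Min B}" B] by simp
    then show False using assms by simp
  qed
  let ?T = "(\<lambda>a. a + Min B) ` A"
  have "?T \<subseteq> A + B"
    using Min_in[OF assms(2) \<open>B \<noteq> {}\<close>] by auto
  moreover have "Max A + Max B \<in> A + B"
    using assms \<open>B \<noteq> {}\<close> by (intro set_plus_intro) auto
  moreover have "Max A + Max B \<notin> ?T"
    using Max_ge[OF assms(1)] \<open>Min B < Max B\<close> by force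
  ultimately have "?T \<subset> A + B" by blast
  then have "card ?T < card (A + B)"
    using assms by (intro psubset_card_mono finite_set_plus)
  then show ?thesis
    by (simp add: card_image)
qed

lemma weak_IASI_edge:
  assumes G: "simple_graph G" and f: "weak_IASI G f" and e: "{u, v} \<in> edges G"
  shows "finite (f u)" "finite (f v)" "f u \<noteq> f v"
    "card (f u + f v) = max (card (f u)) (card (f v))"
    "edge_label f {u, v} = f u + f v"
proof -
  have "card {u, v} = 2" and V: "u \<in> verts G" "v \<in> verts G"
    using G e unfolding simple_graph_def by blast+
  then have "u \<noteq> v" by auto
  then show lab: "edge_label f {u, v} = f u + f v"
    by (rule edge_label_doubleton)
  show "finite (f u)" "finite (f v)"
    using f V by (auto simp: weak_IASI_def IASI_def)
  show "f u \<noteq> f v"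
    using f V \<open>u \<noteq> v\<close> by (auto simp: weak_IASI_def IASI_def dest: inj_onD)
  show "card (f u + f v) = max (card (f u)) (card (f v))"
    using f e lab by (metis weak_IASI_def)
qed

text \<open>An empty label at one end of an edge makes the sum set empty, and weakness then makes the
  label at the other end empty too, against injectivity.\<close>

lemma weak_IASI_edge_nonempty:
  assumes "simple_graph G" "weak_IASI G f" "{u, v} \<in> edges G"
  shows "f u \<noteq> {}" "f v \<noteq> {}"
proof -
  note * = weak_IASI_edge[OF assms]
  have "f u + f v = {}" if "f u = {} \<or> f v = {}"
    using that by (auto simp: set_plus_def)
  then have "f u = {} \<and> f v = {}" if "f u = {} \<or> f v = {}"
    using that * by auto
  then show "f u \<noteq> {}" "f v \<noteq> {}" using *(3) by metis+
qed

lemma weak_IASI_independent: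
  assumes G: "simple_graph G" and f: "weak_IASI G f"
  defines "I \<equiv> {v. card (f v) \<noteq> 1}"
  shows "independent G I" "mono_indexed_edges G f = {e \<in> edges G. e \<inter> I = {}}"
proof -
  have pos: "card (f u) \<ge> 1" "card (f v) \<ge> 1" if "{u, v} \<in> edges G" for u v
    using weak_IASI_edge[OF G f that] weak_IASI_edge_nonempty[OF G f that]
    by (simp_all add: Suc_le_eq card_gt_0_iff)
  show "independent G I"
    unfolding independent_def
  proof (intro allI impI)
    fix u v assume e: "{u, v} \<in> edges G"
    note * = weak_IASI_edge[OF G f e] weak_IASI_edge_nonempty[OF G f e]
    show "u \<notin> I \<or> v \<notin> I"
    proof (rule ccontr)
      assume "\<not> (u \<notin> I \<or> v \<notin> I)"
      then have "card (f u) \<ge> 2" "card (f v) \<ge> 2"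
        using pos[OF e] by (auto simp: I_def)
      then have "card (f u) < card (f u + f v)" "card (f v) < card (f v + f u)"
        using *(1,2,6,7) by (simp_all add: card_less_card_sumset)
      then show False
        using *(4) by (simp add: add.commute)
    qed
  qed
  have "card (edge_label f e) = 1 \<longleftrightarrow> e \<inter> I = {}" if e: "e \<in> edges G" for e
  proof -
    obtain u v where uv: "e = {u, v}"
      using G e by (rule simple_graph_edgeE)
    have "card (edge_label f e) = max (card (f u)) (card (f v))"
      using weak_IASI_edge[OF G f, of u v] e uv by simp
    then show ?thesis
      using pos[of u v] e uv by (auto simp: I_def)
  qed
  then show "mono_indexed_edges G f = {e \<in> edges G. e \<inter> I = {}}"
    by (auto simp: mono_indexed_edges_def)
qed

text \<open>Give vertex number \<open>i\<close> the label \<open>{2^i}\<close>, or \<open>{2^i, 2^i + 1}\<close> if it is in the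
  independent set. The minimum of an edge label is then the sum of two distinct powers of two, from
  which the edge can be read off.\<close>

lemma independent_weak_IASI:
  assumes G: "simple_graph G" and I: "independent G I"
  obtains f where "weak_IASI G f" "mono_indexed_edges G f = {e \<in> edges G. e \<inter> I = {}}"
proof -
  obtain i :: "'a \<Rightarrow> nat" where i: "inj_on i (verts G)"
    using G finite_imp_inj_to_nat_seg[of "verts G"] by (auto simp: simple_graph_def)
  define f :: "'a \<Rightarrow> nat set" where "f v = (if v \<in> I then {2 ^ i v, 2 ^ i v + 1} else {2 ^ i v})" for v
  have fin: "finite (f v)" and ne: "f v \<noteq> {}" and Min_f: "Min (f v) = 2 ^ i v"
    and card_f: "card (f v) = (if v \<in> I then 2 else 1)" for v
    by (auto simp: f_def)
  have lab: "edge_label f {u, v} = f u + f v" if "{u, v} \<in> edges G" for u v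
  proof -
    have "card {u, v} = 2" using G that unfolding simple_graph_def by blast
    then show ?thesis by (intro edge_label_doubleton) auto
  qed
  have card_lab: "card (edge_label f {u, v}) = max (card (f u)) (card (f v))"
    if "{u, v} \<in> edges G" for u v
  proof -
    have sums: "{a} + {b, b + 1} = {a + b, a + b + 1}" "{b, b + 1} + {a} = {b + a, b + a + 1}"
      "{a} + {b} = {a + b}" for a b :: nat
      by (auto simp: set_plus_def)
    have "u \<notin> I \<or> v \<notin> I" using I that by (simp add: independent_def)
    then consider "u \<notin> I" "v \<notin> I" | "u \<notin> I" "v \<in> I" | "u \<in> I" "v \<notin> I" by blast
    then have "card (f u + f v) = max (card (f u)) (card (f v))"
      by cases (simp_all only: card_f, simp_all only: f_def sums if_True if_False, simp_all)
    then show ?thesis by (simp add: lab that)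
  qed
  have Min_lab: "Min (edge_label f e) = set_encode (i ` e)" if e: "e \<in> edges G" for e
  proof -
    obtain u v where uv: "e = {u, v}" "u \<noteq> v" "u \<in> verts G" "v \<in> verts G"
      using G e by (rule simple_graph_edgeE)
    have "Min (f u + f v) = Min (f u) + Min (f v)"
    proof (rule Min_eqI)
      show "finite (f u + f v)" by (intro finite_set_plus fin)
      show "Min (f u) + Min (f v) \<in> f u + f v"
        by (intro set_plus_intro Min_in fin ne)
      show "Min (f u) + Min (f v) \<le> y" if "y \<in> f u + f v" for y
        using that Min_le[OF fin] by (auto elim!: set_plus_elim intro: add_mono)
    qed
    moreover have "i u \<noteq> i v" using i uv by (auto dest: inj_onD)
    ultimately show ?thesis
      using e uv lab[of u v] by (simp add: Min_f set_encode_def)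
  qed
  have "inj_on f (verts G)"
  proof (rule inj_onI)
    fix u v assume "u \<in> verts G" "v \<in> verts G" "f u = f v"
    moreover from this have "(2::nat) ^ i u = 2 ^ i v" by (metis Min_f)
    ultimately show "u = v" using i by (auto dest: inj_onD)
  qed
  moreover have "inj_on (edge_label f) (edges G)"
  proof (rule inj_onI)
    fix d e assume de: "d \<in> edges G" "e \<in> edges G" "edge_label f d = edge_label f e"
    have sub: "d \<subseteq> verts G" "e \<subseteq> verts G"
      using G de by (auto simp: simple_graph_def)
    then have "finite d" "finite e"
      using G finite_subset by (auto simp: simple_graph_def)
    moreover have "set_encode (i ` d) = set_encode (i ` e)"
      using de Min_lab by metis
    ultimately have "i ` d = i ` e"
      by (simp add: set_encode_eq)
    then show "d = e"
      using inj_on_image_eq_iff[OF i sub] by simp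
  qed
  ultimately have "weak_IASI G f"
    using fin card_lab by (simp add: weak_IASI_def IASI_def)
  moreover have "card (edge_label f e) = 1 \<longleftrightarrow> e \<inter> I = {}" if e: "e \<in> edges G" for e
  proof -
    obtain u v where uv: "e = {u, v}"
      using G e by (rule simple_graph_edgeE)
    then show ?thesis
      using card_lab[of u v] e by (auto simp: card_f)
  qed
  ultimately show thesis
    by (intro that[of f]) (auto simp: mono_indexed_edges_def)
qed

lemma sparing_number_eqI:
  assumes G: "simple_graph G"
    and I: "independent G I" "card {e \<in> edges G. e \<inter> I = {}} = k"
    and lower: "\<And>J. independent G J \<Longrightarrow> k \<le> card {e \<in> edges G. e \<inter> J = {}}"
  shows "sparing_number G = k"
  unfolding sparing_number_def
proof (rule Least_equality)
  show "\<exists>f. weak_IASI G f \<and> card (mono_indexed_edges G f) = k"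
    using independent_weak_IASI[OF G I(1)] I(2) by metis
  show "k \<le> l" if l: "\<exists>f. weak_IASI G f \<and> card (mono_indexed_edges G f) = l" for l
  proof -
    obtain f where f: "weak_IASI G f" and card_f: "card (mono_indexed_edges G f) = l"
      using l by blast
    show ?thesis
      using lower[OF weak_IASI_independent(1)[OF G f]]
      unfolding card_f[symmetric] weak_IASI_independent(2)[OF G f] .
  qed
qed

section \<open>The cliques of an edge corona\<close>

definition pairs :: "'a set \<Rightarrow> 'a set set" where
  "pairs S = {d. d \<subseteq> S \<and> card d = 2}"

definition corona_clique :: "'b ugraph \<Rightarrow> 'a set \<Rightarrow> ('a + 'a set \<times> 'b) set" where
  "corona_clique K e = Inl ` e \<union> Inr ` ({e} \<times> verts K)"

lemma pairs_iff: "d \<in> pairs S \<longleftrightarrow> (\<exists>u v. d = {u, v} \<and> u \<noteq> v \<and> u \<in> S \<and> v \<in> S)"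
  unfolding pairs_def card_2_iff by auto

lemma card_pairs: "finite S \<Longrightarrow> card (pairs S) = card S choose 2"
  unfolding pairs_def by (rule n_subsets)

lemma edges_complete_graph: "complete_graph n K \<Longrightarrow> edges K = pairs (verts K)"
  unfolding complete_graph_def by (simp add: set_eq_iff pairs_iff conj_ac)

lemma corona_clique:
  assumes "simple_graph G" "complete_graph n K" "e \<in> edges G"
  shows "finite (corona_clique K e)" "card (corona_clique K e) = n + 2"
proof -
  have "finite e" "card e = 2" "finite (verts K)" "card (verts K) = n"
    using assms by (auto simp: simple_graph_def complete_graph_def intro: finite_subset)
  then show "finite (corona_clique K e)" "card (corona_clique K e) = n + 2"
    unfolding corona_clique_def
    by (simp, subst card_Un_disjoint) (auto simp: card_image card_cartesian_product_singleton)
qed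

lemma pairs_corona_clique:
  assumes "card e = 2" "complete_graph n K"
  shows "pairs (corona_clique K e) =
    {Inl ` e} \<union> {(\<lambda>w. Inr (e, w)) ` d | d. d \<in> edges K} \<union>
    {{Inl v, Inr (e, w)} | v w. v \<in> e \<and> w \<in> verts K}"
    (is "?L = ?R")
proof
  obtain a b where e: "e = {a, b}" "a \<noteq> b"
    using assms(1) by (auto simp: card_2_iff)
  show "?L \<subseteq> ?R"
  proof
    fix d assume "d \<in> ?L"
    then obtain x y where d: "d = {x, y}" "x \<noteq> y"
      and xy: "x \<in> corona_clique K e" "y \<in> corona_clique K e"
      by (auto simp: pairs_iff)
    consider
        u v where "x = Inl u" "y = Inl v" "u \<in> e" "v \<in> e"
      | u w where "x = Inl u" "y = Inr (e, w)" "u \<in> e" "w \<in> verts K"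
      | u w where "x = Inr (e, w)" "y = Inl u" "u \<in> e" "w \<in> verts K"
      | w z where "x = Inr (e, w)" "y = Inr (e, z)" "w \<in> verts K" "z \<in> verts K"
      using xy unfolding corona_clique_def by blast
    then show "d \<in> ?R"
    proof cases
      case 1
      then have "d = Inl ` e" using d e by auto
      then show ?thesis by blast
    next
      case 2
      then show ?thesis using d by blast
    next
      case 3
      then have "d = {Inl u, Inr (e, w)}" using d by auto
      then show ?thesis using 3 by blast
    next
      case 4
      then have "d = (\<lambda>w. Inr (e, w)) ` {w, z}" "{w, z} \<in> edges K"
        using d by (auto simp: edges_complete_graph[OF assms(2)] pairs_iff)
      then show ?thesis by blast
    qed
  qed
  show "?R \<subseteq> ?L"
  proof
    fix d assume "d \<in> ?R"
    then consider "d = Inl ` e"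
      | c where "d = (\<lambda>w. Inr (e, w)) ` c" "c \<in> pairs (verts K)"
      | v w where "d = {Inl v, Inr (e, w)}" "v \<in> e" "w \<in> verts K"
      using edges_complete_graph[OF assms(2)] by auto
    then show "d \<in> ?L"
    proof cases
      case 1
      then show ?thesis
        using assms(1) by (auto simp: pairs_def corona_clique_def card_image)
    next
      case 2
      then show ?thesis
        by (auto simp: pairs_def corona_clique_def card_image inj_on_def)
    next
      case 3
      then show ?thesis
        by (auto simp: pairs_def corona_clique_def)
    qed
  qed
qed

lemma edges_edge_corona:
  assumes "simple_graph G" "complete_graph n K"
  shows "edges (edge_corona G K) = (\<Union>e\<in>edges G. pairs (corona_clique K e))"
proof -
  have "(\<Union>e\<in>edges G. pairs (corona_clique K e)) = (\<Union>e\<in>edges G.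
    {Inl ` e} \<union> {(\<lambda>w. Inr (e, w)) ` d | d. d \<in> edges K} \<union>
    {{Inl v, Inr (e, w)} | v w. v \<in> e \<and> w \<in> verts K})"
    using assms by (intro SUP_cong pairs_corona_clique) (auto simp: simple_graph_def)
  then show ?thesis
    unfolding edge_corona_def by auto
qed

text \<open>A vertex common to the cliques of distinct edges \<open>d\<close> and \<open>e\<close> is an end of both, as the
  two copies of \<open>K\<close> are disjoint. Two such vertices would therefore force \<open>d = e\<close>.\<close>

lemma disjoint_pairs_corona_clique:
  fixes K :: "'b ugraph" and d e :: "'a set"
  assumes "card d = 2" "card e = 2" "d \<noteq> e"
  shows "pairs (corona_clique K d) \<inter> pairs (corona_clique K e) = {}"
proof (rule equals0I)
  fix x :: "('a + 'a set \<times> 'b) set"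
  assume "x \<in> pairs (corona_clique K d) \<inter> pairs (corona_clique K e)"
  then have x: "x \<subseteq> corona_clique K d" "x \<subseteq> corona_clique K e" "card x = 2"
    by (auto simp: pairs_def)
  then have "x \<subseteq> Inl ` d" "x \<subseteq> Inl ` e"
    using assms(3) unfolding corona_clique_def by blast+
  moreover have "card x = card (Inl ` c :: ('a + 'a set \<times> 'b) set)" "finite c"
    if "card c = 2" for c :: "'a set"
    using that x(3) by (auto simp: card_image intro: card_ge_0_finite)
  ultimately have "x = Inl ` d" "x = Inl ` e"
    using assms by (metis card_subset_eq finite_imageI)+
  then show False
    using assms(3) by (metis inj_Inl inj_image_eq_iff)
qed

lemma card_edges_avoiding:
  assumes G: "simple_graph G" and K: "complete_graph n K"
  shows "card {d \<in> edges (edge_corona G K). d \<inter> I = {}}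
    = (\<Sum>e\<in>edges G. card (corona_clique K e - I) choose 2)"
proof -
  have "{d \<in> edges (edge_corona G K). d \<inter> I = {}} = (\<Union>e\<in>edges G. pairs (corona_clique K e - I))"
    unfolding edges_edge_corona[OF G K] pairs_def by blast
  also have "card \<dots> = (\<Sum>e\<in>edges G. card (pairs (corona_clique K e - I)))"
  proof (rule card_UN_disjoint)
    show "finite (edges G)" using G by (rule finite_edges)
    show "\<forall>e\<in>edges G. finite (pairs (corona_clique K e - I))"
      using corona_clique(1)[OF G K] by (simp add: pairs_def)
    show "\<forall>d\<in>edges G. \<forall>e\<in>edges G. d \<noteq> e \<longrightarrow>
        pairs (corona_clique K d - I) \<inter> pairs (corona_clique K e - I) = {}"
    proof (intro ballI impI)
      fix d e assume "d \<in> edges G" "e \<in> edges G" "d \<noteq> e"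
      then have "pairs (corona_clique K d) \<inter> pairs (corona_clique K e) = {}"
        using G by (intro disjoint_pairs_corona_clique) (auto simp: simple_graph_def)
      moreover have "pairs (corona_clique K c - I) \<subseteq> pairs (corona_clique K c)" for c :: "'a set"
        by (auto simp: pairs_def)
      ultimately show "pairs (corona_clique K d - I) \<inter> pairs (corona_clique K e - I) = {}"
        by blast
    qed
  qed
  also have "\<dots> = (\<Sum>e\<in>edges G. card (corona_clique K e - I) choose 2)"
    by (intro sum.cong refl card_pairs finite_Diff corona_clique(1)[OF G K])
  finally show ?thesis .
qed

section \<open>The sparing number\<close>

lemma sparing_number_edge_corona_complete:
  assumes G: "simple_graph G" and K: "complete_graph n K" and n: "n \<ge> 1"
  shows "sparing_number (edge_corona G K) = card (edges G) * (Suc n choose 2)"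
proof -
  let ?C = "edge_corona G K"
  obtain w where w: "w \<in> verts K"
    using K n by (cases "verts K = {}") (auto simp: complete_graph_def)
  define I :: "('a + 'a set \<times> 'b) set" where "I = Inr ` (edges G \<times> {w})"
  have edge: "{x, y} \<in> edges ?C \<longleftrightarrow>
      (\<exists>e\<in>edges G. x \<in> corona_clique K e \<and> y \<in> corona_clique K e \<and> x \<noteq> y)" for x y
    unfolding edges_edge_corona[OF G K] by (auto simp: pairs_def card_2_iff doubleton_eq_iff)
  show ?thesis
  proof (rule sparing_number_eqI)
    show "simple_graph ?C"
      by (rule simple_graph_edge_corona[OF G simple_graph_complete[OF K]])
    show "independent ?C I"
      unfolding independent_def edge by (auto simp: I_def corona_clique_def)
    have "card (corona_clique K e - I) = Suc n" if e: "e \<in> edges G" for e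
    proof -
      have "corona_clique K e - I = corona_clique K e - {Inr (e, w)}"
        using e by (auto simp: I_def corona_clique_def)
      moreover have "Inr (e, w) \<in> corona_clique K e"
        using w by (simp add: corona_clique_def)
      ultimately show ?thesis
        using corona_clique[OF G K e] by simp
    qed
    then show "card {d \<in> edges ?C. d \<inter> I = {}} = card (edges G) * (Suc n choose 2)"
      by (simp add: card_edges_avoiding[OF G K])
  next
    fix J assume J: "independent ?C J"
    have "Suc n choose 2 \<le> card (corona_clique K e - J) choose 2" if e: "e \<in> edges G" for e
    proof -
      have "x = y" if "x \<in> corona_clique K e \<inter> J" "y \<in> corona_clique K e \<inter> J" for x y
        using J that e unfolding independent_def edge by blast
      moreover have "finite (corona_clique K e \<inter> J)"
        using corona_clique(1)[OF G K e] by simp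
      ultimately have "card (corona_clique K e \<inter> J) \<le> 1"
        by (simp add: card_le_Suc0_iff_eq)
      then have "Suc n \<le> card (corona_clique K e - J)"
        using corona_clique[OF G K e] by (simp add: card_Diff_subset_Int)
      then show ?thesis by (rule binomial_right_mono)
    qed
    then have "(\<Sum>e\<in>edges G. Suc n choose 2)
        \<le> (\<Sum>e\<in>edges G. card (corona_clique K e - J) choose 2)"
      by (rule sum_mono)
    then show "card (edges G) * (Suc n choose 2) \<le> card {d \<in> edges ?C. d \<inter> J = {}}"
      by (simp add: card_edges_avoiding[OF G K])
  qed
qed

lemma card_edges_path_graph:
  assumes "path_graph m P"
  shows "card (edges P) = m - 1"
proof -
  obtain p where p: "bij_betw p {..<m} (verts P)"
    and E: "edges P = {{p i, p (Suc i)} | i. Suc i < m}"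
    using assms by (auto simp: path_graph_def)
  have "edges P = (\<lambda>i. {p i, p (Suc i)}) ` {..<m - 1}"
    unfolding E by (auto simp: less_diff_conv)
  moreover have "inj_on (\<lambda>i. {p i, p (Suc i)}) {..<m - 1}"
  proof (rule inj_onI)
    fix i j assume ij: "i \<in> {..<m - 1}" "j \<in> {..<m - 1}"
      and "{p i, p (Suc i)} = {p j, p (Suc j)}"
    then have "p ` {i, Suc i} = p ` {j, Suc j}"
      by simp
    moreover have "{i, Suc i} \<subseteq> {..<m}" "{j, Suc j} \<subseteq> {..<m}"
      using ij by auto
    ultimately have "{i, Suc i} = {j, Suc j}"
      using inj_on_image_eq_iff[OF bij_betw_imp_inj_on[OF p]] by blast
    then show "i = j"
      by (auto simp: doubleton_eq_iff)
  qed
  ultimately show ?thesis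
    by (simp add: card_image)
qed

theorem theorem2p11:
  fixes P :: "'a ugraph" and K :: "'b ugraph" and m n :: nat
  assumes "m \<ge> 2" and "n \<ge> 1"
    and "path_graph m P" and "complete_graph n K"
  shows "real (sparing_number (edge_corona P K)) = 1 / 2 * real n * (real n + 1) * (real m - 1)"
proof -
  have "sparing_number (edge_corona P K) = (m - 1) * (Suc n choose 2)"
    using sparing_number_edge_corona_complete[OF simple_graph_path[OF assms(3)] assms(4,2)]
      card_edges_path_graph[OF assms(3)] by simp
  moreover have "real (Suc n choose 2) = real n * (real n + 1) / 2"
    by (simp add: choose_two real_of_nat_div field_simps)
  ultimately show ?thesis
    using assms(1) by (simp add: of_nat_diff)
qed

end
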